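(* Let $(V,\omega)$ be a symplectic vector space with $\dim V=4$. There exist no $C^\infty(V)$-linear maps $$\widetilde{r_2^\omega}:\Gamma(\wedge^2V^*\otimes\wedge^2V^* )\to\Gamma(\wedge^3V^*\otimes V),\qquad\widetilde{r_3^\omega}:\Gamma(\wedge^3V^*\otimes\wedge^2V^* )\to\Gamma(\wedge^4V^*\otimes V)$$ which are left inverses of $\phi_3^\omega$ and $\phi_4^\omega$ respectively and satisfy $$\widetilde{r_2^\omega}\,\partial_3+d_4\,\widetilde{r_3^\omega}=0.$$
   Context: $\Gamma(U)=C^\infty(V,U)$ for a finite-dimensional vector space $U$; $\{e_i\},\{e^i\}$ dual bases of $V,V^*$, $x^i$ linear coordinates, repeated indices summed. $\phi_p^\omega:\Gamma(\wedge^pV^*\otimes V)\to\Gamma(\wedge^{p-1}V^*\otimes\wedge^2V^* )$ is the $C^\infty(V)$-linear map $\phi_p^\omega(\alpha\otimes X)=(-1)^{p-1}\iota_{e_i}(\alpha)\otimes e^i\wedge\iota_X\omega$. $d_p(\alpha\otimes v)=x^i\iota_{e_i}(\alpha)\otimes v$ maps $\Gamma(\wedge^pV^*\otimes V)$ to $\Gamma(\wedge^{p-1}V^*\otimes V)$, and $\partial_p(\alpha\otimes\tau)=-x^i\iota_{e_i}(\alpha)\otimes\tau$ maps $\Gamma(\wedge^pV^*\otimes\wedge^2V^* )$ to $\Gamma(\wedge^{p-1}V^*\otimes\wedge^2V^* )$. *)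

theory Defs
  imports "HOL-Analysis.Analysis"
begin

(* Continuously differentiable k times / infinitely often on the whole space. *)

primrec Ck :: "nat \<Rightarrow> ('a::real_normed_vector \<Rightarrow> 'b::real_normed_vector) \<Rightarrow> bool" where
  "Ck 0 f \<longleftrightarrow> continuous_on UNIV f"
| "Ck (Suc k) f \<longleftrightarrow> (\<forall>x. f differentiable (at x)) \<and>
     (\<forall>v. Ck k (\<lambda>x. frechet_derivative f (at x) v))"

definition smooth :: "('a::real_normed_vector \<Rightarrow> 'b::real_normed_vector) \<Rightarrow> bool" where
  "smooth f \<longleftrightarrow> (\<forall>k. Ck k f)"

(* Alternating p-linear maps V^p -> W, as functions of the list of arguments that are 0 on
   lists of any other length (so that equality of forms is equality of functions). For W = R
   this is the p-th exterior power of V*; for general W it is its tensor product with W,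
   where alpha \<otimes> w is the map vs |-> alpha(vs) w. *)

definition alt_forms :: "nat \<Rightarrow> ('v::real_vector list \<Rightarrow> 'w::real_vector) set" where
  "alt_forms p = {\<alpha>.
     (\<forall>vs. length vs \<noteq> p \<longrightarrow> \<alpha> vs = 0) \<and>
     (\<forall>us ws. length us + length ws + 1 = p \<longrightarrow> linear (\<lambda>v. \<alpha> (us @ v # ws))) \<and>
     (\<forall>vs. \<not> distinct vs \<longrightarrow> \<alpha> vs = 0)}"

(* The tensor product of the p-th and q-th exterior powers of V*: alternating p-linear maps
   with values in alternating q-forms; alpha \<otimes> tau is vs ws |-> alpha(vs) tau(ws). *)

definition bi_alt_forms :: "nat \<Rightarrow> nat \<Rightarrow> ('v::real_vector list \<Rightarrow> 'v list \<Rightarrow> real) set" where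
  "bi_alt_forms p q = {\<tau>. (\<forall>ws. (\<lambda>vs. \<tau> vs ws) \<in> alt_forms p) \<and> (\<forall>vs. \<tau> vs \<in> alt_forms q)}"

(* Smooth maps from V into these finite-dimensional spaces. The evaluations at fixed arguments
   span the dual of the target, so a map is smooth iff all its evaluations are. *)

definition vec_sections :: "nat \<Rightarrow> ('v::euclidean_space \<Rightarrow> 'v list \<Rightarrow> 'v) set" where
  "vec_sections p = {F. (\<forall>x. F x \<in> alt_forms p) \<and> (\<forall>vs. smooth (\<lambda>x. F x vs))}"

definition form_sections ::
    "nat \<Rightarrow> nat \<Rightarrow> ('v::euclidean_space \<Rightarrow> 'v list \<Rightarrow> 'v list \<Rightarrow> real) set" where
  "form_sections p q =
     {\<tau>. (\<forall>x. \<tau> x \<in> bi_alt_forms p q) \<and> (\<forall>vs ws. smooth (\<lambda>x. \<tau> x vs ws))}"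

definition symplectic_form :: "('v::real_vector list \<Rightarrow> real) \<Rightarrow> bool" where
  "symplectic_form \<omega> \<longleftrightarrow> \<omega> \<in> alt_forms 2 \<and> (\<forall>v. (\<forall>w. \<omega> [v, w] = 0) \<longrightarrow> v = 0)"

(* The value type 'u also covers forms with values in forms. *)

definition interior :: "'v \<Rightarrow> ('v list \<Rightarrow> 'u) \<Rightarrow> 'v list \<Rightarrow> 'u" where
  "interior X \<alpha> = (\<lambda>vs. \<alpha> (X # vs))"

(* The dual basis vector e* in V* (that is, a 1-form) of a vector e of the basis B; its value
   at x is the linear coordinate of x along e. *)

definition dual_vec :: "'v::real_vector set \<Rightarrow> 'v \<Rightarrow> 'v list \<Rightarrow> real" where
  "dual_vec B e = (\<lambda>vs. case vs of [v] \<Rightarrow> representation B v e | _ \<Rightarrow> 0)"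

(* Wedge product of two 1-forms, normalised as a \<otimes> b - b \<otimes> a. *)

definition wedge1 :: "('v list \<Rightarrow> real) \<Rightarrow> ('v list \<Rightarrow> real) \<Rightarrow> 'v list \<Rightarrow> real" where
  "wedge1 \<alpha> \<beta> =
     (\<lambda>ws. case ws of [a, b] \<Rightarrow> \<alpha> [a] * \<beta> [b] - \<alpha> [b] * \<beta> [a] | _ \<Rightarrow> 0)"

(* On alpha \<otimes> X this is (-1)^(p-1) times the sum over e in B of
   interior e alpha \<otimes> (e* wedge interior X omega), see phi_tensor below. *)

definition phi :: "'v::real_vector set \<Rightarrow> ('v list \<Rightarrow> real) \<Rightarrow> nat
    \<Rightarrow> ('v \<Rightarrow> 'v list \<Rightarrow> 'v) \<Rightarrow> ('v \<Rightarrow> 'v list \<Rightarrow> 'v list \<Rightarrow> real)" where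
  "phi B \<omega> p F = (\<lambda>x vs ws. (- 1) ^ (p - 1) *
     (\<Sum>e\<in>B. wedge1 (dual_vec B e) (interior (interior e (F x) vs) \<omega>) ws))"

(* The formulas for the two differentials are the same in every degree p. *)

definition d_op :: "'v::real_vector set
    \<Rightarrow> ('v \<Rightarrow> 'v list \<Rightarrow> 'v) \<Rightarrow> ('v \<Rightarrow> 'v list \<Rightarrow> 'v)" where
  "d_op B F = (\<lambda>x vs. \<Sum>e\<in>B. dual_vec B e [x] *\<^sub>R interior e (F x) vs)"

definition del_op :: "'v::real_vector set
    \<Rightarrow> ('v \<Rightarrow> 'v list \<Rightarrow> 'v list \<Rightarrow> real) \<Rightarrow> ('v \<Rightarrow> 'v list \<Rightarrow> 'v list \<Rightarrow> real)" where
  "del_op B \<tau> = (\<lambda>x vs ws. - (\<Sum>e\<in>B. dual_vec B e [x] * interior e (\<tau> x) vs ws))"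

definition smooth_linear :: "nat \<Rightarrow> nat \<Rightarrow> nat
    \<Rightarrow> (('v::euclidean_space \<Rightarrow> 'v list \<Rightarrow> 'v list \<Rightarrow> real) \<Rightarrow> ('v \<Rightarrow> 'v list \<Rightarrow> 'v)) \<Rightarrow> bool" where
  "smooth_linear p q p' r \<longleftrightarrow>
     r \<in> form_sections p q \<rightarrow> vec_sections p' \<and>
     (\<forall>\<sigma>\<in>form_sections p q. \<forall>\<tau>\<in>form_sections p q.
        r (\<lambda>x vs ws. \<sigma> x vs ws + \<tau> x vs ws) = (\<lambda>x vs. r \<sigma> x vs + r \<tau> x vs)) \<and>
     (\<forall>f. \<forall>\<tau>\<in>form_sections p q. smooth f \<longrightarrow>
        r (\<lambda>x vs ws. f x * \<tau> x vs ws) = (\<lambda>x vs. f x *\<^sub>R r \<tau> x vs))"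

(* The operators on sections alpha \<otimes> X and alpha \<otimes> tau. *)

lemma interior_scaleR:
  assumes "\<omega> \<in> alt_forms 2"
  shows "interior (c *\<^sub>R X) \<omega> [w] = c * interior X \<omega> [w]"
proof -
  have "\<forall>us ws. length us + length ws + 1 = 2 \<longrightarrow> linear (\<lambda>v. \<omega> (us @ v # ws))"
    using assms unfolding alt_forms_def by blast
  from this[rule_format, of "[]" "[w]"] have "linear (\<lambda>v. \<omega> [v, w])" by simp
  from linear_scale[OF this, of c X] show ?thesis by (simp add: interior_def)
qed

lemma phi_tensor:
  assumes "\<omega> \<in> alt_forms 2"
  shows "phi B \<omega> p (\<lambda>x vs. \<alpha> x vs *\<^sub>R X x) = (\<lambda>x vs ws. (- 1) ^ (p - 1) *
    (\<Sum>e\<in>B. interior e (\<alpha> x) vs * wedge1 (dual_vec B e) (interior (X x) \<omega>) ws))"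
proof -
  have "wedge1 \<beta> (interior (c *\<^sub>R Y) \<omega>) ws = c * wedge1 \<beta> (interior Y \<omega>) ws" for \<beta> c Y ws
    by (auto simp: wedge1_def interior_scaleR[OF assms] algebra_simps split: list.splits)
  then show ?thesis
    by (simp add: phi_def interior_def[of _ "\<lambda>vs. \<alpha> _ vs *\<^sub>R X _"] interior_def[of _ "\<alpha> _"])
qed

lemma d_op_tensor:
  "d_op B (\<lambda>x vs. \<alpha> x vs *\<^sub>R X x) =
     (\<lambda>x vs. (\<Sum>e\<in>B. dual_vec B e [x] * interior e (\<alpha> x) vs) *\<^sub>R X x)"
  by (simp add: d_op_def interior_def scaleR_sum_left)

lemma del_op_tensor:
  "del_op B (\<lambda>x vs ws. \<alpha> x vs * \<tau> x ws) =
     (\<lambda>x vs ws. - (\<Sum>e\<in>B. dual_vec B e [x] * interior e (\<alpha> x) vs) * \<tau> x ws)"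
  by (simp add: del_op_def interior_def sum_distrib_right mult.assoc)

end

theory Submission
  imports Defs
begin

text \<open>
  Let \<open>vol\<close> be a volume form on \<open>V\<close>, \<open>\<beta>\<close> a constant 2-form, and write \<open>\<iota>\<close> for contraction.
  The section \<open>E\<close> with value \<open>\<iota>\<^sub>x vol \<otimes> \<beta>\<close> at \<open>x\<close> satisfies \<open>\<partial> E = 0\<close>, because
  \<open>\<iota>\<^sub>x \<iota>\<^sub>x vol = 0\<close>. Hence the relation \<open>r\<^sub>2 \<partial> + d r\<^sub>3 = 0\<close> gives \<open>d (r\<^sub>3 E) = 0\<close>: the
  contraction of the top-degree form \<open>r\<^sub>3 E\<close> with the Euler vector field vanishes, so \<open>r\<^sub>3 E\<close> is zero
  away from the origin. On the other hand \<open>r\<^sub>3 E\<close> is \<open>\<Sum>\<^sub>i x\<^sup>i G\<^sub>i\<close> with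
  \<open>G\<^sub>i = r\<^sub>3 (\<iota> e\<^sub>i vol \<otimes> \<beta>)\<close>, by linearity over the smooth functions. On the line through
  \<open>e\<^sub>j\<close> only the term of \<open>G\<^sub>j\<close> survives, so \<open>G\<^sub>j\<close> vanishes there except possibly at the
  origin, and by continuity at the origin too. This is lemma \<open>r_contracted_top_form_eq_0\<close>; it says
  that \<open>r\<^sub>3\<close> is zero at the origin on all constant sections \<open>\<iota> e\<^sub>j vol \<otimes> \<beta>\<close>.

  But \<open>\<phi>\<^sub>4 (vol \<otimes> X)\<close> is a sum of such sections, so
  \<open>r\<^sub>3 (\<phi>\<^sub>4 (vol \<otimes> X))\<close> is zero at the origin and cannot be \<open>vol \<otimes> X\<close> when
  \<open>X \<noteq> 0\<close>. For \<open>vol\<close> the proof takes half the square of \<open>\<omega>\<close>; nondegeneracy of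
  \<open>\<omega>\<close> makes it nonzero (lemma \<open>liouville_nonzero\<close>).
\<close>

section \<open>Alternating forms\<close>

lemma alt_forms_linear:
  assumes "\<alpha> \<in> alt_forms p"
  shows "linear (\<lambda>v. \<alpha> (us @ v # ws))"
proof (cases "length us + length ws + 1 = p")
  case True
  then show ?thesis using assms unfolding alt_forms_def by blast
next
  case False
  then have "\<alpha> (us @ v # ws) = 0" for v
    using assms unfolding alt_forms_def by auto
  then show ?thesis by (simp add: module_hom_zero)
qed

lemma alt_forms_linear_Cons: "\<alpha> \<in> alt_forms p \<Longrightarrow> linear (\<lambda>v. \<alpha> (v # ws))"
  using alt_forms_linear[of \<alpha> p "[]"] by simp

lemma alt_forms_linear_Cons2: "\<alpha> \<in> alt_forms p \<Longrightarrow> linear (\<lambda>v. \<alpha> (u # v # ws))"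
  using alt_forms_linear[of \<alpha> p "[u]"] by simp

lemma alt_forms_not_distinct: "\<alpha> \<in> alt_forms p \<Longrightarrow> \<not> distinct vs \<Longrightarrow> \<alpha> vs = 0"
  unfolding alt_forms_def by blast

lemma alt_forms_length: "\<alpha> \<in> alt_forms p \<Longrightarrow> length vs \<noteq> p \<Longrightarrow> \<alpha> vs = 0"
  unfolding alt_forms_def by blast

text \<open>Expanding the value at a list that has \<open>a + b\<close> in both places gives the sign rule.\<close>

lemma alt_forms_swap:
  assumes "\<alpha> \<in> alt_forms p"
  shows "\<alpha> (us @ a # ms @ b # ws) = - \<alpha> (us @ b # ms @ a # ws)"
proof -
  have l1: "\<alpha> (us @ (x + y) # zs) = \<alpha> (us @ x # zs) + \<alpha> (us @ y # zs)" for x y zs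
    using linear_add[OF alt_forms_linear[OF assms, of us zs]] .
  have l2: "\<alpha> (us @ z # ms @ (x + y) # ws) =
      \<alpha> (us @ z # ms @ x # ws) + \<alpha> (us @ z # ms @ y # ws)" for x y z
    using linear_add[OF alt_forms_linear[OF assms, of "us @ z # ms" ws], of x y] by simp
  have z: "\<alpha> (us @ x # ms @ x # ws) = 0" for x
    by (rule alt_forms_not_distinct[OF assms]) simp
  have "0 = \<alpha> (us @ (a + b) # ms @ (a + b) # ws)" by (simp only: z)
  also have "\<dots> = \<alpha> (us @ a # ms @ b # ws) + \<alpha> (us @ b # ms @ a # ws)"
    unfolding l1 l2 by (simp add: z)
  finally show ?thesis by (simp add: eq_neg_iff_add_eq_0)
qed

lemma alt_forms_eq_0_if_0_on_spanning:
  assumes "\<alpha> \<in> alt_forms p" and "span B = UNIV"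
    and "\<And>vs. set vs \<subseteq> B \<Longrightarrow> \<alpha> vs = 0"
  shows "\<alpha> vs = 0"
proof -
  \<comment> \<open>The arguments in \<open>us\<close> are released from \<open>B\<close> one at a time, the last one first.\<close>
  have "set ws \<subseteq> B \<Longrightarrow> \<alpha> (us @ ws) = 0" for us ws
  proof (induction us arbitrary: ws rule: rev_induct)
    case Nil
    then show ?case using assms(3) by simp
  next
    case (snoc v us)
    have "linear (\<lambda>v. \<alpha> (us @ v # ws))" by (rule alt_forms_linear[OF assms(1)])
    moreover have "\<And>b. b \<in> B \<Longrightarrow> \<alpha> (us @ b # ws) = 0"
      using snoc by simp
    ultimately have "\<alpha> (us @ v # ws) = 0"
      using linear_eq_0_on_span[of "\<lambda>v. \<alpha> (us @ v # ws)" B v] assms(2) by auto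
    then show ?case by simp
  qed
  from this[of "[]" vs] show ?thesis by simp
qed

text \<open>
  In top degree, contraction with a single basis vector is injective: a list of basis vectors on
  which the form could be nonzero enumerates the whole basis, so it contains \<open>e\<close>, and a swap
  brings \<open>e\<close> to the front.
\<close>

lemma top_form_eq_0:
  assumes "\<alpha> \<in> alt_forms (card B)" and "finite B" and "span B = UNIV"
    and "e \<in> B" and "interior e \<alpha> = (\<lambda>_. 0)"
  shows "\<alpha> vs = 0"
proof (rule alt_forms_eq_0_if_0_on_spanning[OF assms(1,3)])
  fix vs :: "'a list"
  assume "set vs \<subseteq> B"
  show "\<alpha> vs = 0"
  proof (cases "length vs = card B \<and> distinct vs")
    case True
    then have "set vs = B"
      using \<open>set vs \<subseteq> B\<close> \<open>finite B\<close> by (simp add: card_subset_eq distinct_card)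
    then obtain ms ws where vs: "vs = ms @ e # ws"
      using \<open>e \<in> B\<close> by (meson split_list)
    have 0: "\<alpha> (e # us) = 0" for us
      using fun_cong[OF assms(5), of us] by (simp add: interior_def)
    show ?thesis
    proof (cases ms)
      case Nil
      then show ?thesis by (simp add: vs 0)
    next
      case (Cons a ms')
      then show ?thesis
        using alt_forms_swap[OF assms(1), of "[]" a ms' e ws] by (simp add: vs 0)
    qed
  next
    case False
    then show ?thesis
      using alt_forms_length[OF assms(1)] alt_forms_not_distinct[OF assms(1)] by blast
  qed
qed

lemma interior_alt_forms:
  assumes "\<alpha> \<in> alt_forms (Suc p)"
  shows "interior e \<alpha> \<in> alt_forms p"
proof -
  have "linear (\<lambda>v. \<alpha> (e # us @ v # ws))" for us ws
    using alt_forms_linear[OF assms, of "e # us" ws] by simp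
  then show ?thesis
    using assms by (auto simp: alt_forms_def interior_def)
qed

lemma linear_comp_alt_forms:
  assumes "\<alpha> \<in> alt_forms p" and "linear f"
  shows "(\<lambda>vs. f (\<alpha> vs)) \<in> alt_forms p"
proof -
  have "linear (\<lambda>v. f (\<alpha> (us @ v # ws)))" for us ws
    using linear_compose[OF alt_forms_linear[OF assms(1)] assms(2), of us ws] by (simp add: o_def)
  then show ?thesis
    using assms(1) linear_0[OF assms(2)] by (auto simp: alt_forms_def)
qed

lemma tensor_bi_alt_forms:
  assumes "\<alpha> \<in> alt_forms p" and "\<beta> \<in> alt_forms q"
  shows "(\<lambda>vs ws. \<alpha> vs * \<beta> ws) \<in> bi_alt_forms p q"
proof -
  have "linear (\<lambda>y::real. y * c)" "linear (\<lambda>y::real. c * y)" for c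
    by (auto intro!: linearI simp: algebra_simps)
  from linear_comp_alt_forms[OF assms(1) this(1)] linear_comp_alt_forms[OF assms(2) this(2)]
  show ?thesis by (simp add: bi_alt_forms_def)
qed

lemma wedge1_alt_forms:
  assumes "linear (\<lambda>v. \<alpha> [v])" and "linear (\<lambda>v. \<beta> [v])"
  shows "wedge1 \<alpha> \<beta> \<in> alt_forms 2"
proof -
  have "linear (\<lambda>v. wedge1 \<alpha> \<beta> (us @ v # ws))" if l: "length us + length ws = 1" for us ws
  proof -
    consider b where "us = []" "ws = [b]" | a where "us = [a]" "ws = []"
      using l by (cases us; cases ws) auto
    then show ?thesis
      by cases (auto intro!: linearI simp: wedge1_def algebra_simps
          linear_add[OF assms(1)] linear_add[OF assms(2)]
          linear_scale[OF assms(1)] linear_scale[OF assms(2)])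
  qed
  then show ?thesis
    by (auto simp: alt_forms_def wedge1_def split: list.splits)
qed


section \<open>The Liouville volume form\<close>

text \<open>
  This is \<open>\<omega> \<and> \<omega> / 2\<close>, with the sum over all permutations of the four arguments reduced to the
  three ways of pairing them.
\<close>

definition liouville :: "('v list \<Rightarrow> real) \<Rightarrow> 'v list \<Rightarrow> real" where
  "liouville \<omega> = (\<lambda>vs. case vs of
     [a, b, c, d] \<Rightarrow> \<omega> [a, b] * \<omega> [c, d] - \<omega> [a, c] * \<omega> [b, d] + \<omega> [a, d] * \<omega> [b, c]
   | _ \<Rightarrow> 0)"

lemma liouville_alt_forms:
  assumes "\<omega> \<in> alt_forms 2"
  shows "liouville \<omega> \<in> alt_forms 4"
proof -
  note l1 = alt_forms_linear_Cons[OF assms] and l2 = alt_forms_linear_Cons2[OF assms]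
  note lin = linear_add[OF l1] linear_add[OF l2] linear_scale[OF l1] linear_scale[OF l2]
  have alt: "\<omega> [a, a] = 0" for a
    by (rule alt_forms_not_distinct[OF assms]) simp
  have anti: "\<omega> [a, b] = - \<omega> [b, a]" for a b
    using alt_forms_swap[OF assms, of "[]" a "[]" b "[]"] by simp
  have "linear (\<lambda>v. liouville \<omega> (us @ v # ws))" if l: "length us + length ws = 3" for us ws
  proof -
    obtain x y z where "us @ ws = [x, y, z]"
      using l by (auto simp: numeral_3_eq_3 length_Suc_conv simp flip: length_append)
    then consider b c d where "us = []" "ws = [b, c, d]" | a c d where "us = [a]" "ws = [c, d]"
      | a b d where "us = [a, b]" "ws = [d]" | a b c where "us = [a, b, c]" "ws = []"
      by (auto simp: append_eq_Cons_conv)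
    then show ?thesis
      by cases (auto intro!: linearI simp: liouville_def algebra_simps lin)
  qed
  moreover have "liouville \<omega> vs = 0" if nd: "\<not> distinct vs" for vs
  proof (cases "length vs = 4")
    case True
    then obtain a b c d where vs: "vs = [a, b, c, d]"
      by (auto simp: numeral_eq_Suc length_Suc_conv)
    then consider "a = b" | "a = c" | "a = d" | "b = c" | "b = d" | "c = d"
      using nd by auto
    then show ?thesis
      by cases (simp_all add: vs liouville_def alt anti[of b a] anti[of c a] anti[of c b] anti[of d b]
          anti[of d c])
  next
    case False
    then show ?thesis by (auto simp: liouville_def split: list.splits)
  qed
  ultimately show ?thesis
    by (auto simp: alt_forms_def liouville_def split: list.splits)
qed

text \<open>
  Two pairs \<open>u, w\<close> and \<open>c, d\<close>, neither \<open>\<omega>\<close>-orthogonal, with \<open>c\<close> orthogonal to both \<open>u\<close> and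
  \<open>w\<close> reduce the three pairings to \<open>\<omega>(u, w) \<omega>(c, d)\<close>. Such a \<open>c \<noteq> 0\<close> exists
  because two linear conditions cannot cut a space of dimension above 2 down to 0.
\<close>

lemma liouville_nonzero:
  fixes \<omega> :: "'v::euclidean_space list \<Rightarrow> real"
  assumes "symplectic_form \<omega>" and "DIM('v) > 2"
  shows "\<exists>vs. liouville \<omega> vs \<noteq> 0"
proof -
  have \<omega>: "\<omega> \<in> alt_forms 2" and nd: "\<And>v. v \<noteq> 0 \<Longrightarrow> \<exists>w. \<omega> [v, w] \<noteq> 0"
    using assms(1) by (auto simp: symplectic_form_def)
  obtain u :: 'v where "u \<noteq> 0"
    using nonzero_Basis nonempty_Basis by blast
  then obtain w where w: "\<omega> [u, w] \<noteq> 0" using nd by blast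
  define f where "f v = (\<omega> [u, v], \<omega> [w, v])" for v
  note l = alt_forms_linear_Cons2[OF \<omega>, of _ "[]"]
  have f: "linear f"
    by (auto intro!: linearI simp: f_def linear_add[OF l] linear_scale[OF l])
  have "\<not> inj f"
  proof
    assume "inj f"
    then have "dim (f ` UNIV) = DIM('v)"
      using dim_image_eq[OF f, of UNIV] by simp
    moreover have "dim (f ` UNIV) \<le> DIM(real \<times> real)"
      by (rule dim_subset_UNIV)
    ultimately show False using assms(2) by simp
  qed
  then obtain c where "c \<noteq> 0" and "f c = 0"
    using linear_injective_0[OF f] by blast
  then obtain d where "\<omega> [c, d] \<noteq> 0" using nd by blast
  with w \<open>f c = 0\<close> have "liouville \<omega> [u, w, c, d] \<noteq> 0"
    by (simp add: liouville_def f_def zero_prod_def)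
  then show ?thesis ..
qed


section \<open>Smooth sections\<close>

lemma smooth_const:
  fixes c :: "'b::real_normed_vector"
  shows "smooth (\<lambda>x::'a::real_normed_vector. c)"
proof -
  have "Ck k (\<lambda>x::'a. d)" for k and d :: 'b
    by (induction k arbitrary: d) (auto simp: frechet_derivative_const)
  then show ?thesis by (simp add: smooth_def)
qed

lemma smooth_if_linear:
  fixes f :: "'a::euclidean_space \<Rightarrow> 'b::real_normed_vector"
  assumes "linear f"
  shows "smooth f"
proof -
  have bl: "bounded_linear f" using assms by (simp add: linear_conv_bounded_linear)
  have "(f has_derivative f) (at x)" for x
    by (rule bounded_linear_imp_has_derivative[OF bl])
  then have "frechet_derivative f (at x) = f" "f differentiable (at x)" for x
    by (metis frechet_derivative_at, metis differentiableI)
  moreover have "continuous_on UNIV f"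
    using bl by (simp add: linear_continuous_on)
  ultimately have "Ck k f" for k
    using smooth_const by (cases k) (auto simp: smooth_def)
  then show ?thesis by (simp add: smooth_def)
qed

lemma smooth_add:
  assumes "smooth f" and "smooth g"
  shows "smooth (\<lambda>x. f x + g x)"
proof -
  have "Ck k f \<Longrightarrow> Ck k g \<Longrightarrow> Ck k (\<lambda>x. f x + g x)" for k
  proof (induction k arbitrary: f g)
    case 0
    then show ?case by (auto intro: continuous_on_add)
  next
    case (Suc k)
    have "frechet_derivative (\<lambda>x. f x + g x) (at x) =
        (\<lambda>v. frechet_derivative f (at x) v + frechet_derivative g (at x) v)" for x
      using Suc.prems by (intro frechet_derivative_at[symmetric] has_derivative_add)
        (simp_all flip: frechet_derivative_works)
    with Suc show ?case by auto
  qed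
  with assms show ?thesis by (simp add: smooth_def)
qed

lemma smooth_continuous: "smooth f \<Longrightarrow> continuous_on UNIV f"
  unfolding smooth_def by (metis Ck.simps(1))

lemma zero_form_sections: "(\<lambda>x vs ws. 0) \<in> form_sections p q"
  by (auto simp: form_sections_def bi_alt_forms_def alt_forms_def smooth_const module_hom_zero)

lemma add_form_sections:
  assumes "\<sigma> \<in> form_sections p q" and "\<tau> \<in> form_sections p q"
  shows "(\<lambda>x vs ws. \<sigma> x vs ws + \<tau> x vs ws) \<in> form_sections p q"
  using assms
  by (auto simp: form_sections_def bi_alt_forms_def alt_forms_def intro!: smooth_add linear_compose_add)

lemma tensor_form_sections:
  assumes "\<alpha> \<in> alt_forms p" and "\<beta> \<in> alt_forms q"
  shows "(\<lambda>x vs ws. \<alpha> vs * \<beta> ws) \<in> form_sections p q"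
  using tensor_bi_alt_forms[OF assms] by (simp add: form_sections_def smooth_const)

lemma linear_tensor_form_sections:
  assumes "\<alpha> \<in> alt_forms (Suc p)" and "\<beta> \<in> alt_forms q" and "linear f"
  shows "(\<lambda>x vs ws. interior (f x) \<alpha> vs * \<beta> ws) \<in> form_sections p q"
proof -
  have "linear (\<lambda>x. \<alpha> (f x # vs) * \<beta> ws)" for vs ws
    using linear_compose[OF assms(3) alt_forms_linear_Cons[OF assms(1)], of vs]
    by (auto intro!: linearI simp: linear_iff algebra_simps)
  then show ?thesis
    using tensor_bi_alt_forms[OF interior_alt_forms[OF assms(1)] assms(2)]
    by (auto simp: form_sections_def interior_def intro!: smooth_if_linear)
qed

lemma smooth_linear_add:
  assumes "smooth_linear p q p' r" and "\<sigma> \<in> form_sections p q" and "\<tau> \<in> form_sections p q"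
  shows "r (\<lambda>x vs ws. \<sigma> x vs ws + \<tau> x vs ws) = (\<lambda>x vs. r \<sigma> x vs + r \<tau> x vs)"
  using assms unfolding smooth_linear_def by simp

lemma smooth_linear_scale:
  assumes "smooth_linear p q p' r" and "\<tau> \<in> form_sections p q" and "smooth f"
  shows "r (\<lambda>x vs ws. f x * \<tau> x vs ws) = (\<lambda>x vs. f x *\<^sub>R r \<tau> x vs)"
  using assms unfolding smooth_linear_def by simp

lemma smooth_linear_zero:
  assumes "smooth_linear p q p' r"
  shows "r (\<lambda>x vs ws. 0) = (\<lambda>x vs. 0)"
  using smooth_linear_scale[OF assms zero_form_sections smooth_const[of 0]] by simp

text \<open>
  The products of the coefficients with the sections are assumed to be sections; in the applications
  the coefficients are constant or linear and the sections constant, which spares the Leibniz rule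
  for products of smooth functions.
\<close>

lemma smooth_linear_sum:
  assumes r: "smooth_linear p q p' r" and "finite S"
    and f: "\<And>e. e \<in> S \<Longrightarrow> smooth (f e)"
    and \<tau>: "\<And>e. e \<in> S \<Longrightarrow> \<tau> e \<in> form_sections p q"
    and f\<tau>: "\<And>e. e \<in> S \<Longrightarrow> (\<lambda>x vs ws. f e x * \<tau> e x vs ws) \<in> form_sections p q"
  shows "r (\<lambda>x vs ws. \<Sum>e\<in>S. f e x * \<tau> e x vs ws) = (\<lambda>x vs. \<Sum>e\<in>S. f e x *\<^sub>R r (\<tau> e) x vs)"
proof -
  have "(\<lambda>x vs ws. \<Sum>e\<in>S. f e x * \<tau> e x vs ws) \<in> form_sections p q \<and>
      r (\<lambda>x vs ws. \<Sum>e\<in>S. f e x * \<tau> e x vs ws) = (\<lambda>x vs. \<Sum>e\<in>S. f e x *\<^sub>R r (\<tau> e) x vs)"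
    using \<open>finite S\<close> f \<tau> f\<tau>
  proof (induction S)
    case empty
    then show ?case using smooth_linear_zero[OF r] zero_form_sections by simp
  next
    case (insert e S)
    let ?s = "\<lambda>x vs ws. f e x * \<tau> e x vs ws"
    let ?t = "\<lambda>x vs ws. \<Sum>e\<in>S. f e x * \<tau> e x vs ws"
    have s: "?s \<in> form_sections p q" and t: "?t \<in> form_sections p q"
      using insert by auto
    have "r ?s = (\<lambda>x vs. f e x *\<^sub>R r (\<tau> e) x vs)"
      by (rule smooth_linear_scale[OF r insert.prems(2,1)]) simp_all
    moreover have "r ?t = (\<lambda>x vs. \<Sum>e\<in>S. f e x *\<^sub>R r (\<tau> e) x vs)"
      using insert by auto
    moreover have "r (\<lambda>x vs ws. ?s x vs ws + ?t x vs ws) = (\<lambda>x vs. r ?s x vs + r ?t x vs)"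
      by (rule smooth_linear_add[OF r s t])
    ultimately have "r (\<lambda>x vs ws. ?s x vs ws + ?t x vs ws) =
        (\<lambda>x vs. f e x *\<^sub>R r (\<tau> e) x vs + (\<Sum>e\<in>S. f e x *\<^sub>R r (\<tau> e) x vs))"
      by simp
    then show ?case
      using add_form_sections[OF s t] insert.hyps by simp
  qed
  then show ?thesis ..
qed


section \<open>The obstruction\<close>

lemma sum_representation_linear:
  fixes f :: "'v::real_vector \<Rightarrow> 'w::real_vector"
  assumes "linear f" and "independent B" and "span B = UNIV" and "finite B"
  shows "(\<Sum>e\<in>B. representation B x e *\<^sub>R f e) = f x"
proof -
  have "f x = f (\<Sum>e\<in>B. representation B x e *\<^sub>R e)"
    using assms by (simp add: sum_representation_eq)
  then show ?thesis
    by (simp add: linear_sum[OF assms(1)] linear_scale[OF assms(1)])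
qed

lemma linear_dual_vec:
  assumes "independent B" and "span B = UNIV"
  shows "linear (\<lambda>v. dual_vec B e [v])"
  using assms
  by (auto intro!: linearI simp: dual_vec_def representation_add representation_scale)

text \<open>
  The relation is applied to the section \<open>E\<close> with value \<open>\<iota>\<^sub>x \<alpha> \<otimes> \<beta>\<close> at \<open>x\<close>, and
  the result is read off along the line through the basis vector \<open>e\<close>.
\<close>

lemma r_contracted_top_form_eq_0:
  fixes B :: "'v::euclidean_space set"
  assumes B: "independent B" "span B = UNIV" and p: "card B = Suc p"
    and r2: "smooth_linear (p - 1) q p r\<^sub>2" and r3: "smooth_linear p q (Suc p) r\<^sub>3"
    and comm: "\<And>\<tau> x vs. \<tau> \<in> form_sections p q \<Longrightarrow>
      r\<^sub>2 (del_op B \<tau>) x vs + d_op B (r\<^sub>3 \<tau>) x vs = 0"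
    and \<alpha>: "\<alpha> \<in> alt_forms (Suc p)" and \<beta>: "\<beta> \<in> alt_forms q" and e: "e \<in> B"
  shows "r\<^sub>3 (\<lambda>x vs ws. interior e \<alpha> vs * \<beta> ws) 0 vs = 0"
proof -
  have fin: "finite B" using p card.infinite by fastforce
  define T where "T b = (\<lambda>(x::'v) vs ws. interior b \<alpha> vs * \<beta> ws)" for b
  define E where "E = (\<lambda>x vs ws. interior x \<alpha> vs * \<beta> ws)"
  have T: "T b \<in> form_sections p q" for b
    unfolding T_def by (rule tensor_form_sections[OF interior_alt_forms[OF \<alpha>] \<beta>])
  have E: "E \<in> form_sections p q"
    unfolding E_def by (rule linear_tensor_form_sections[OF \<alpha> \<beta> linear_id[unfolded id_def]])
  have "del_op B E = (\<lambda>x vs ws. 0)"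
  proof (intro ext)
    fix x vs ws
    have "(\<Sum>b\<in>B. representation B x b *\<^sub>R \<alpha> (x # b # vs)) = \<alpha> (x # x # vs)"
      by (rule sum_representation_linear[OF alt_forms_linear_Cons2[OF \<alpha>] B fin])
    also have "\<dots> = 0" by (rule alt_forms_not_distinct[OF \<alpha>]) simp
    finally show "del_op B E x vs ws = 0"
      by (simp add: del_op_def E_def interior_def dual_vec_def flip: sum_distrib_right mult.assoc)
  qed
  then have d: "d_op B (r\<^sub>3 E) x vs = 0" for x vs
    using comm[OF E, of x vs] smooth_linear_zero[OF r2] by simp
  have ET: "E = (\<lambda>x vs ws. \<Sum>b\<in>B. dual_vec B b [x] * T b x vs ws)"
  proof (intro ext)
    fix x vs ws
    have "(\<Sum>b\<in>B. representation B x b *\<^sub>R \<alpha> (b # vs)) = \<alpha> (x # vs)"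
      by (rule sum_representation_linear[OF alt_forms_linear_Cons[OF \<alpha>] B fin])
    then show "E x vs ws = (\<Sum>b\<in>B. dual_vec B b [x] * T b x vs ws)"
      by (simp add: E_def T_def interior_def dual_vec_def flip: sum_distrib_right mult.assoc)
  qed
  have "(\<lambda>x vs ws. dual_vec B b [x] * T b x vs ws) \<in> form_sections p q" for b
  proof -
    \<comment> \<open>This section is \<open>E\<close> precomposed with the projection to the line through \<open>b\<close>.\<close>
    have "linear (\<lambda>x. dual_vec B b [x] *\<^sub>R b)"
      using linear_dual_vec[OF B, of b]
      by (auto intro!: linearI simp: linear_iff algebra_simps)
    from linear_tensor_form_sections[OF \<alpha> \<beta> this] show ?thesis
      by (simp add: T_def interior_def linear_scale[OF alt_forms_linear_Cons[OF \<alpha>]] mult.assoc)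
  qed
  then have rE: "r\<^sub>3 E = (\<lambda>x vs. \<Sum>b\<in>B. dual_vec B b [x] *\<^sub>R r\<^sub>3 (T b) x vs)"
    unfolding ET
    by (intro smooth_linear_sum[OF r3 fin] smooth_if_linear linear_dual_vec[OF B] T)
  have G: "r\<^sub>3 (T e) \<in> vec_sections (Suc p)"
    using r3 T[of e] unfolding smooth_linear_def by blast
  have dual: "dual_vec B b [t *\<^sub>R e] = (if b = e then t else 0)" for b t
    using B e by (simp add: dual_vec_def representation_scale representation_basis)
  have ray: "r\<^sub>3 (T e) (t *\<^sub>R e) (e # vs) = 0" if "t \<noteq> 0" for t vs
  proof -
    have coord: "(\<Sum>b\<in>B. dual_vec B b [t *\<^sub>R e] *\<^sub>R h b) = t *\<^sub>R h e" for h :: "'v \<Rightarrow> 'v"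
      using e fin by (simp add: dual if_distrib[of "\<lambda>c. c *\<^sub>R _"] cong: if_cong)
    \<comment> \<open>One factor \<open>t\<close> comes from the expansion of \<open>r\<^sub>3 E\<close>, the other from \<open>d\<close>.\<close>
    have "t *\<^sub>R t *\<^sub>R r\<^sub>3 (T e) (t *\<^sub>R e) (e # vs) = d_op B (r\<^sub>3 E) (t *\<^sub>R e) vs"
      unfolding d_op_def rE interior_def coord ..
    then show ?thesis using d that by simp
  qed
  have "r\<^sub>3 (T e) 0 (e # vs) = 0" for vs
  proof -
    let ?g = "\<lambda>x. r\<^sub>3 (T e) x (e # vs)"
    have "continuous_on UNIV ?g"
      using G by (simp add: vec_sections_def smooth_continuous)
    then have "isCont ?g 0" by (simp add: continuous_on_eq_continuous_at)
    moreover have "(\<lambda>n. inverse (real (Suc n)) *\<^sub>R e) \<longlonglongrightarrow> 0"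
      using tendsto_scaleR[OF LIMSEQ_inverse_real_of_nat tendsto_const[of e]] by simp
    ultimately have "(\<lambda>n. ?g (inverse (real (Suc n)) *\<^sub>R e)) \<longlonglongrightarrow> ?g 0"
      by (rule isCont_tendsto_compose)
    then show ?thesis by (simp add: ray LIMSEQ_const_iff del: of_nat_Suc)
  qed
  then have "interior e (r\<^sub>3 (T e) 0) = (\<lambda>_. 0)"
    by (simp add: interior_def fun_eq_iff)
  moreover have "r\<^sub>3 (T e) 0 \<in> alt_forms (card B)"
    using G p by (simp add: vec_sections_def)
  ultimately have "r\<^sub>3 (T e) 0 vs = 0"
    using top_form_eq_0[OF _ fin B(2) e] by blast
  then show ?thesis by (simp add: T_def)
qed

theorem propositionA5:
  fixes \<omega> :: "'v::euclidean_space list \<Rightarrow> real" and B :: "'v set"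
  assumes "DIM('v) = 4"
    and "symplectic_form \<omega>"
    and "independent B" and "span B = UNIV"
  shows "\<not> (\<exists>r\<^sub>2 r\<^sub>3.
      smooth_linear 2 2 3 r\<^sub>2 \<and> smooth_linear 3 2 4 r\<^sub>3 \<and>
      (\<forall>F\<in>vec_sections 3. r\<^sub>2 (phi B \<omega> 3 F) = F) \<and>
      (\<forall>F\<in>vec_sections 4. r\<^sub>3 (phi B \<omega> 4 F) = F) \<and>
      (\<forall>\<tau>\<in>form_sections 3 2. \<forall>x vs.
         r\<^sub>2 (del_op B \<tau>) x vs + d_op B (r\<^sub>3 \<tau>) x vs = 0))"
proof
  assume "\<exists>r\<^sub>2 r\<^sub>3.
      smooth_linear 2 2 3 r\<^sub>2 \<and> smooth_linear 3 2 4 r\<^sub>3 \<and>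
      (\<forall>F\<in>vec_sections 3. r\<^sub>2 (phi B \<omega> 3 F) = F) \<and>
      (\<forall>F\<in>vec_sections 4. r\<^sub>3 (phi B \<omega> 4 F) = F) \<and>
      (\<forall>\<tau>\<in>form_sections 3 2. \<forall>x vs.
         r\<^sub>2 (del_op B \<tau>) x vs + d_op B (r\<^sub>3 \<tau>) x vs = 0)"
  then obtain r\<^sub>2 r\<^sub>3 where r2: "smooth_linear 2 2 3 r\<^sub>2" and r3: "smooth_linear 3 2 4 r\<^sub>3"
    and inv: "\<And>F. F \<in> vec_sections 4 \<Longrightarrow> r\<^sub>3 (phi B \<omega> 4 F) = F"
    and comm: "\<And>\<tau> x vs. \<tau> \<in> form_sections 3 2 \<Longrightarrow>
         r\<^sub>2 (del_op B \<tau>) x vs + d_op B (r\<^sub>3 \<tau>) x vs = 0"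
    by auto
  have \<omega>: "\<omega> \<in> alt_forms 2" using assms(2) by (simp add: symplectic_form_def)
  have fin: "finite B" using assms(3) independent_bound by blast
  have card: "card B = 4"
    using basis_card_eq_dim[of B UNIV] assms by simp
  obtain us where us: "liouville \<omega> us \<noteq> 0"
    using liouville_nonzero[OF assms(2)] assms(1) by auto
  obtain X :: 'v where X: "X \<noteq> 0" using nonzero_Basis nonempty_Basis by blast
  note vol = liouville_alt_forms[OF \<omega>]
  define F where "F = (\<lambda>(x::'v) vs. liouville \<omega> vs *\<^sub>R X)"
  define \<beta> where "\<beta> e = wedge1 (dual_vec B e) (interior X \<omega>)" for e
  have F: "F \<in> vec_sections 4"
  proof -
    have "linear (\<lambda>c. c *\<^sub>R X)" by (auto intro!: linearI simp: algebra_simps)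
    from linear_comp_alt_forms[OF vol this] show ?thesis
      by (simp add: vec_sections_def F_def smooth_const)
  qed
  have \<beta>: "\<beta> e \<in> alt_forms 2" for e
    unfolding \<beta>_def
    using linear_dual_vec[OF assms(3,4)] alt_forms_linear_Cons2[OF \<omega>, of X "[]"]
    by (intro wedge1_alt_forms) (simp_all add: interior_def)
  let ?T = "\<lambda>e (x::'v) vs ws. interior e (liouville \<omega>) vs * \<beta> e ws"
  have vol': "liouville \<omega> \<in> alt_forms (Suc 3)" using vol by simp
  have T: "?T e \<in> form_sections 3 2" for e
    by (rule tensor_form_sections[OF interior_alt_forms[OF vol'] \<beta>])
  have mT: "(\<lambda>x vs ws. - 1 * ?T e x vs ws) \<in> form_sections 3 2" for e
  proof -
    have "linear (\<lambda>y::real. - y)" by (auto intro!: linearI)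
    from linear_comp_alt_forms[OF interior_alt_forms[OF vol'] this]
    show ?thesis using tensor_form_sections[OF _ \<beta>] by fastforce
  qed
  have phiF: "phi B \<omega> 4 F = (\<lambda>x vs ws. \<Sum>e\<in>B. - 1 * ?T e x vs ws)"
    unfolding F_def phi_tensor[OF \<omega>] \<beta>_def by (simp add: sum_negf)
  have "F = r\<^sub>3 (phi B \<omega> 4 F)" using inv[OF F] by simp
  also have "\<dots> = (\<lambda>x vs. \<Sum>e\<in>B. - 1 *\<^sub>R r\<^sub>3 (?T e) x vs)"
    unfolding phiF by (rule smooth_linear_sum[OF r3 fin smooth_const T mT])
  finally have "F 0 us = (\<Sum>e\<in>B. - 1 *\<^sub>R r\<^sub>3 (?T e) 0 us)" by (rule fun_cong[OF fun_cong])
  also have "\<dots> = 0"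
    using r_contracted_top_form_eq_0[OF assms(3,4), of 3 2 r\<^sub>2 r\<^sub>3] card r2 r3 comm vol' \<beta>
    by (intro sum.neutral ballI) simp
  finally show False using us X by (simp add: F_def)
qed

end
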